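(* Let $G$ be a group and $\pi=\{C_1,\dots,C_\ell\}$ a collection of $\ell$ distinct subsets of $G$, each of size $k$ and containing $e$, pairwise intersecting exactly in $\{e\}$ and satisfying the $T$-axiom. Let $AH$ be the automorphism group of the hypergraph $CH(G,\pi)$, and identify $G$ with the subgroup $\{\mathcal{L}_g: g\in G\}$ of $AH$. Then \[ N_{AH}(G)\cap\{\varphi\in AH:\varphi(e)=e\}\cong \mathrm{Aut}(G,\pi). \]
   Context: For $C\subseteq G$ and $g\in G$, $gC=\{gs:s\in C\}$. A collection $\pi$ of subsets of $G$, each containing $e$, satisfies the $T$-axiom if for every $C\in\pi$ and $s\in C$, $s^{-1}C\in\pi$. The hypergraph $CH(G,\pi)$ has vertex set $G$ and hyperedge set $\{gC:g\in G,C\in\pi\}$; its automorphisms are permutations of $G$ mapping the set of hyperedges bijectively onto itself. $\mathcal{L}_g:G\to G$, $x\mapsto gx$ is left translation. $N_{AH}(G)$ is the normalizer of $G$ in $AH$. $\mathrm{Aut}(G,\pi)$ is the set of group automorphisms $\varphi$ of $G$ that induce a permutation of $\pi$, i.e. for each $i$ there is $j$ with $\varphi(C_i)=C_j$. *)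

theory Defs
  imports "HOL-Algebra.Algebra"
begin

definition T_axiom :: "('a, 'b) monoid_scheme \<Rightarrow> 'a set set \<Rightarrow> bool"
  where "T_axiom G \<pi> \<longleftrightarrow> (\<forall>C\<in>\<pi>. \<forall>s\<in>C. (inv\<^bsub>G\<^esub> s) <#\<^bsub>G\<^esub> C \<in> \<pi>)"

definition CH_edges :: "('a, 'b) monoid_scheme \<Rightarrow> 'a set set \<Rightarrow> 'a set set"
  where "CH_edges G \<pi> = {g <#\<^bsub>G\<^esub> C | g C. g \<in> carrier G \<and> C \<in> \<pi>}"

text \<open>The automorphism group of the hypergraph with vertex set \<open>V\<close> and hyperedge set \<open>E\<close>.
  As in \<^const>\<open>BijGroup\<close>, permutations of \<open>V\<close> are functions that are \<^const>\<open>undefined\<close> outside \<open>V\<close>,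
  multiplied by composition.\<close>

definition hypergraph_aut :: "'a set \<Rightarrow> 'a set set \<Rightarrow> ('a \<Rightarrow> 'a) monoid"
  where "hypergraph_aut V E = BijGroup V \<lparr>carrier := {\<phi> \<in> Bij V. bij_betw ((`) \<phi>) E E}\<rparr>"

definition CH_aut :: "('a, 'b) monoid_scheme \<Rightarrow> 'a set set \<Rightarrow> ('a \<Rightarrow> 'a) monoid"
  where "CH_aut G \<pi> = hypergraph_aut (carrier G) (CH_edges G \<pi>)"

definition left_translation :: "('a, 'b) monoid_scheme \<Rightarrow> 'a \<Rightarrow> 'a \<Rightarrow> 'a"
  where "left_translation G g = (\<lambda>x\<in>carrier G. g \<otimes>\<^bsub>G\<^esub> x)"

definition left_translations :: "('a, 'b) monoid_scheme \<Rightarrow> ('a \<Rightarrow> 'a) set"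
  where "left_translations G = left_translation G ` carrier G"

definition Aut_pi :: "('a, 'b) monoid_scheme \<Rightarrow> 'a set set \<Rightarrow> ('a \<Rightarrow> 'a) monoid"
  where "Aut_pi G \<pi> = AutoGroup G \<lparr>carrier := {\<phi> \<in> auto G. \<forall>C\<in>\<pi>. \<exists>D\<in>\<pi>. \<phi> ` C = D}\<rparr>"

text \<open>For finite \<open>\<pi>\<close>, mapping members of \<open>\<pi>\<close> to members of \<open>\<pi>\<close> is the same as permuting \<open>\<pi>\<close>.\<close>

lemma Aut_pi_induces_permutation:
  assumes "finite \<pi>" and sub: "\<And>C. C \<in> \<pi> \<Longrightarrow> C \<subseteq> carrier G"
  shows "carrier (Aut_pi G \<pi>) = {\<phi> \<in> auto G. bij_betw ((`) \<phi>) \<pi> \<pi>}"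
proof -
  have "(\<forall>C\<in>\<pi>. \<exists>D\<in>\<pi>. \<phi> ` C = D) \<longleftrightarrow> bij_betw ((`) \<phi>) \<pi> \<pi>" if "\<phi> \<in> auto G" for \<phi>
  proof
    assume *: "\<forall>C\<in>\<pi>. \<exists>D\<in>\<pi>. \<phi> ` C = D"
    have "inj_on \<phi> (carrier G)"
      using that by (auto simp: auto_def Bij_def bij_betw_def)
    then have "inj_on ((`) \<phi>) \<pi>"
      by (intro inj_onI) (metis inj_on_image_eq_iff sub)
    moreover have "(`) \<phi> ` \<pi> \<subseteq> \<pi>" using * by auto
    ultimately show "bij_betw ((`) \<phi>) \<pi> \<pi>"
      using assms(1) by (simp add: bij_betw_def endo_inj_surj)
  qed (auto simp: bij_betw_def)
  then show ?thesis by (auto simp: Aut_pi_def)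
qed

text \<open>\<^const>\<open>hypergraph_aut\<close> is a group, and the left translations form a subgroup of it
  isomorphic to \<open>G\<close>; in particular \<^const>\<open>normalizer\<close>, which is meaningful only for subsets of
  the carrier, can be applied to them.\<close>

lemma hypergraph_aut_subgroup:
  assumes E: "\<And>e. e \<in> E \<Longrightarrow> e \<subseteq> V"
  shows "subgroup (carrier (hypergraph_aut V E)) (BijGroup V)"
proof (rule group.subgroupI[OF group_BijGroup])
  show "carrier (hypergraph_aut V E) \<subseteq> carrier (BijGroup V)"
    by (auto simp: hypergraph_aut_def BijGroup_def)
  have "(`) (\<lambda>x\<in>V. x) e = e" if "e \<in> E" for e
    using E[OF that] by (auto simp: image_iff)
  then have "bij_betw ((`) (\<lambda>x\<in>V. x)) E E"
    by (subst bij_betw_cong[where g = id]) auto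
  then show "carrier (hypergraph_aut V E) \<noteq> {}"
    using id_Bij[of V] by (auto simp: hypergraph_aut_def)
next
  fix f assume "f \<in> carrier (hypergraph_aut V E)"
  then have f: "f \<in> Bij V" "bij_betw ((`) f) E E" by (auto simp: hypergraph_aut_def)
  let ?g = "\<lambda>x\<in>V. inv_into V f x"
  have inj: "inj_on f V" and surj: "f ` V = V" using f by (auto simp: Bij_def bij_betw_def)
  have gf: "?g ` (f ` e) = e" if "e \<in> E" for e
  proof -
    have "?g (f x) = x" if "x \<in> e" for x
      using E[OF \<open>e \<in> E\<close>] that inj surj by auto
    then have "(\<lambda>x. ?g (f x)) ` e = (\<lambda>x. x) ` e" by (intro image_cong refl)
    then show ?thesis by (simp only: image_image image_ident)
  qed
  have "bij_betw ((`) ?g) E E"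
  proof (rule bij_betwI[where g = "(`) f"])
    show "(`) f \<in> E \<rightarrow> E" using f(2) by (rule bij_betw_imp_funcset)
    have pre: "\<exists>d\<in>E. e = f ` d" if "e \<in> E" for e
      using bij_betw_imp_surj_on[OF f(2)] that by blast
    show "(`) ?g \<in> E \<rightarrow> E"
    proof
      fix e assume "e \<in> E"
      then obtain d where "d \<in> E" "e = f ` d" using pre by blast
      then show "?g ` e \<in> E" by (simp only: gf)
    qed
    show "?g ` (f ` e) = e" if "e \<in> E" for e using gf[OF that] .
    show "f ` (?g ` e) = e" if "e \<in> E" for e
    proof -
      obtain d where "d \<in> E" "e = f ` d" using pre \<open>e \<in> E\<close> by blast
      then show ?thesis by (simp only: gf)
    qed
  qed
  then show "inv\<^bsub>BijGroup V\<^esub> f \<in> carrier (hypergraph_aut V E)"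
    using f by (simp add: hypergraph_aut_def inv_BijGroup restrict_inv_into_Bij)
next
  fix f g assume "f \<in> carrier (hypergraph_aut V E)" "g \<in> carrier (hypergraph_aut V E)"
  then have fg: "f \<in> Bij V" "bij_betw ((`) f) E E" "g \<in> Bij V" "bij_betw ((`) g) E E"
    by (auto simp: hypergraph_aut_def)
  have "compose V f g ` e = f ` (g ` e)" if "e \<in> E" for e
    using E[OF that] unfolding image_image by (intro image_cong refl) (auto simp: compose_def)
  then have "bij_betw ((`) (compose V f g)) E E \<longleftrightarrow> bij_betw ((`) f \<circ> (`) g) E E"
    by (intro bij_betw_cong) simp
  then show "f \<otimes>\<^bsub>BijGroup V\<^esub> g \<in> carrier (hypergraph_aut V E)"
    using fg by (auto simp: hypergraph_aut_def BijGroup_def compose_Bij intro: bij_betw_trans)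
qed

context group
begin

lemma CH_edges_subset:
  assumes "\<And>C. C \<in> \<pi> \<Longrightarrow> C \<subseteq> carrier G" and "e \<in> CH_edges G \<pi>"
  shows "e \<subseteq> carrier G"
proof -
  obtain g C where "g \<in> carrier G" "C \<in> \<pi>" "e = g <# C"
    using assms(2) by (auto simp: CH_edges_def)
  then show ?thesis using assms(1) l_coset_subset_G by blast
qed

lemma group_CH_aut:
  assumes "\<And>C. C \<in> \<pi> \<Longrightarrow> C \<subseteq> carrier G"
  shows "group (CH_aut G \<pi>)"
proof -
  have "subgroup (carrier (CH_aut G \<pi>)) (BijGroup (carrier G))"
    unfolding CH_aut_def by (rule hypergraph_aut_subgroup) (rule CH_edges_subset[OF assms])
  then have "group (BijGroup (carrier G) \<lparr>carrier := carrier (CH_aut G \<pi>)\<rparr>)"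
    by (rule subgroup.subgroup_is_group) (rule group_BijGroup)
  then show ?thesis by (simp add: CH_aut_def hypergraph_aut_def)
qed

lemma left_translation_hom:
  assumes sub: "\<And>C. C \<in> \<pi> \<Longrightarrow> C \<subseteq> carrier G"
  shows "left_translation G \<in> hom G (CH_aut G \<pi>)"
proof (rule homI)
  have img: "left_translation G g ` e = g <# e" if "e \<subseteq> carrier G" for g e
  proof -
    have "left_translation G g ` e = (\<lambda>x. g \<otimes> x) ` e"
      using that by (intro image_cong refl) (auto simp: left_translation_def)
    then show ?thesis by (auto simp: l_coset_def)
  qed
  have bij: "left_translation G g \<in> Bij (carrier G)" if "g \<in> carrier G" for g
  proof -
    have "bij_betw (\<lambda>x. g \<otimes> x) (carrier G) (carrier G)"
      by (rule bij_betwI[where g = "\<lambda>x. inv g \<otimes> x"])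
         (use that in \<open>auto simp: m_assoc[symmetric]\<close>)
    then have "bij_betw (left_translation G g) (carrier G) (carrier G)"
      by (subst bij_betw_cong[where g = "\<lambda>x. g \<otimes> x"]) (auto simp: left_translation_def)
    then show ?thesis by (simp add: Bij_def left_translation_def)
  qed
  have ed: "g <# e \<in> CH_edges G \<pi>" if ge: "g \<in> carrier G" "e \<in> CH_edges G \<pi>" for g e
  proof -
    obtain h C where "h \<in> carrier G" "C \<in> \<pi>" "e = h <# C"
      using ge by (auto simp: CH_edges_def)
    then have "g <# e = (g \<otimes> h) <# C" using that sub by (simp add: lcos_m_assoc)
    then show ?thesis using that \<open>h \<in> carrier G\<close> \<open>C \<in> \<pi>\<close> by (auto simp: CH_edges_def)
  qed
  fix g assume g: "g \<in> carrier G"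
  note es = CH_edges_subset[OF sub]
  have "bij_betw ((`) (left_translation G g)) (CH_edges G \<pi>) (CH_edges G \<pi>)"
  proof (rule bij_betwI[where g = "\<lambda>e. inv g <# e"])
    show "(`) (left_translation G g) \<in> CH_edges G \<pi> \<rightarrow> CH_edges G \<pi>"
      using img[OF es] ed g by auto
    show "(\<lambda>e. inv g <# e) \<in> CH_edges G \<pi> \<rightarrow> CH_edges G \<pi>"
      using ed g by auto
    show "inv g <# left_translation G g ` e = e" if "e \<in> CH_edges G \<pi>" for e
      using img[OF es[OF _ that]] es[OF _ that] g by (simp add: lcos_m_assoc lcos_mult_one)
    show "left_translation G g ` (inv g <# e) = e" if "e \<in> CH_edges G \<pi>" for e
      using img[OF l_coset_subset_G] es[OF _ that] g by (simp add: lcos_m_assoc lcos_mult_one)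
  qed
  then show "left_translation G g \<in> carrier (CH_aut G \<pi>)"
    using bij[OF g] by (simp add: CH_aut_def hypergraph_aut_def)
  fix h assume h: "h \<in> carrier G"
  show "left_translation G (g \<otimes> h) =
        left_translation G g \<otimes>\<^bsub>CH_aut G \<pi>\<^esub> left_translation G h"
    using bij[OF g] bij[OF h] g h
    by (auto simp: CH_aut_def hypergraph_aut_def BijGroup_def compose_def left_translation_def
        m_assoc fun_eq_iff)
qed

lemma left_translation_inj: "inj_on (left_translation G) (carrier G)"
proof (rule inj_onI)
  fix g h assume "g \<in> carrier G" "h \<in> carrier G" "left_translation G g = left_translation G h"
  then show "g = h"
    by (metis left_translation_def one_closed r_one restrict_apply')
qed

lemma left_translations_subgroup:
  assumes "\<And>C. C \<in> \<pi> \<Longrightarrow> C \<subseteq> carrier G"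
  shows "subgroup (left_translations G) (CH_aut G \<pi>)"
proof -
  have "group_hom G (CH_aut G \<pi>) (left_translation G)"
    using group_CH_aut[OF assms] left_translation_hom[OF assms]
    by (simp add: group_hom_def group_hom_axioms_def)
  then show ?thesis
    unfolding left_translations_def by (rule group_hom.img_is_subgroup)
qed

end

end

theory Submission
  imports Defs
begin

text \<open>Both sides turn out to be the same group of permutations. If \<open>\<phi>\<close> normalizes the left
  translations and fixes \<open>\<one>\<close>, then \<open>\<phi> \<circ> L\<^sub>g = L\<^sub>h \<circ> \<phi>\<close> for some \<open>h\<close>, evaluation at \<open>\<one>\<close> gives
  \<open>h = \<phi> g\<close>, and so \<open>\<phi>\<close> is multiplicative. A member \<open>C\<close> of \<open>\<pi>\<close> is then mapped to a hyperedge
  \<open>h D\<close> that contains \<open>\<one>\<close>; hence \<open>h\<close> is the inverse of an element of \<open>D\<close> and the \<open>T\<close>-axiom puts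
  \<open>h D\<close> into \<open>\<pi>\<close>.\<close>

context group
begin

text \<open>Multiplying by \<open>g\<close> on the right trades conjugation for an equality of
  cosets, so that no inverse permutation has to be computed when this is applied to
  \<open>CH_aut G \<pi>\<close>.\<close>

lemma mem_normalizer_iff:
  assumes H: "H \<subseteq> carrier G"
  shows "g \<in> normalizer G H \<longleftrightarrow> g \<in> carrier G \<and> g <# H = H #> g"
proof -
  have "g <# H #> inv g = H \<longleftrightarrow> g <# H = H #> g" if g: "g \<in> carrier G"
  proof
    assume "g <# H #> inv g = H"
    then have "H #> g = (g <# H #> inv g) #> g" by simp
    also have "\<dots> = g <# H"
      using g H by (simp add: coset_mult_assoc l_coset_subset_G)
    finally show "g <# H = H #> g" by simp
  next
    assume "g <# H = H #> g"
    then show "g <# H #> inv g = H"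
      using g H by (simp add: coset_mult_assoc)
  qed
  \<comment> \<open>The conjugation action in \<open>normalizer_def\<close> is restricted to subsets
    of the carrier; \<open>H\<close> lies in that domain.\<close>
  then show ?thesis
    using H by (auto simp: normalizer_def stabilizer_def)
qed

lemma mem_CH_aut_iff:
  "\<phi> \<in> carrier (CH_aut G \<pi>) \<longleftrightarrow>
    \<phi> \<in> Bij (carrier G) \<and> bij_betw ((`) \<phi>) (CH_edges G \<pi>) (CH_edges G \<pi>)"
  by (simp add: CH_aut_def hypergraph_aut_def)

lemma mult_CH_aut:
  assumes "\<phi> \<in> carrier (CH_aut G \<pi>)" and "\<psi> \<in> carrier (CH_aut G \<pi>)"
  shows "\<phi> \<otimes>\<^bsub>CH_aut G \<pi>\<^esub> \<psi> = compose (carrier G) \<phi> \<psi>"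
  using assms by (simp add: CH_aut_def hypergraph_aut_def BijGroup_def)

text \<open>Both composites are \<open>undefined\<close> outside the carrier, so only values on the
  carrier have to be compared.\<close>

lemma compose_left_translation_eq_iff:
  assumes "\<phi> \<in> carrier G \<rightarrow> carrier G"
  shows "compose (carrier G) \<phi> (left_translation G g) = compose (carrier G) (left_translation G h) \<phi>
    \<longleftrightarrow> (\<forall>x\<in>carrier G. \<phi> (g \<otimes> x) = h \<otimes> \<phi> x)"
  using assms
  by (auto simp: compose_def left_translation_def restrict_def fun_eq_iff Pi_iff)

lemma normalizer_left_translations_iff:
  assumes sub: "\<And>C. C \<in> \<pi> \<Longrightarrow> C \<subseteq> carrier G"
    and \<phi>: "\<phi> \<in> carrier (CH_aut G \<pi>)" and fix1: "\<phi> \<one> = \<one>"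
  shows "\<phi> \<in> normalizer (CH_aut G \<pi>) (left_translations G) \<longleftrightarrow> \<phi> \<in> hom G G"
proof -
  have Lsub: "left_translations G \<subseteq> carrier (CH_aut G \<pi>)"
    using left_translations_subgroup[OF sub] by (rule subgroup.subset)
  have L: "left_translation G g \<in> carrier (CH_aut G \<pi>)" if "g \<in> carrier G" for g
    using Lsub that by (auto simp: left_translations_def)
  have bij: "bij_betw \<phi> (carrier G) (carrier G)"
    using \<phi> by (simp add: mem_CH_aut_iff Bij_def)
  then have fs: "\<phi> \<in> carrier G \<rightarrow> carrier G" by (rule bij_betw_imp_funcset)
  have lcos: "\<phi> <#\<^bsub>CH_aut G \<pi>\<^esub> left_translations G =
      (\<lambda>g. compose (carrier G) \<phi> (left_translation G g)) ` carrier G"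
    using mult_CH_aut[OF \<phi> L] by (auto simp: l_coset_def left_translations_def)
  have rcos: "left_translations G #>\<^bsub>CH_aut G \<pi>\<^esub> \<phi> =
      (\<lambda>h. compose (carrier G) (left_translation G h) \<phi>) ` carrier G"
    using mult_CH_aut[OF L \<phi>] by (auto simp: r_coset_def left_translations_def)
  have "\<phi> <#\<^bsub>CH_aut G \<pi>\<^esub> left_translations G = left_translations G #>\<^bsub>CH_aut G \<pi>\<^esub> \<phi>
      \<longleftrightarrow> \<phi> \<in> hom G G"
  proof
    assume eq: "\<phi> <#\<^bsub>CH_aut G \<pi>\<^esub> left_translations G = left_translations G #>\<^bsub>CH_aut G \<pi>\<^esub> \<phi>"
    show "\<phi> \<in> hom G G"
    proof (rule homI)
      fix g x assume g: "g \<in> carrier G" and x: "x \<in> carrier G"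
      have "compose (carrier G) \<phi> (left_translation G g) \<in>
          (\<lambda>h. compose (carrier G) (left_translation G h) \<phi>) ` carrier G"
        using eq g unfolding lcos rcos by blast
      then obtain h where h: "h \<in> carrier G"
        and eqh: "\<forall>x\<in>carrier G. \<phi> (g \<otimes> x) = h \<otimes> \<phi> x"
        using compose_left_translation_eq_iff[OF fs] by auto
      have "\<phi> g = h" using eqh[rule_format, of \<one>] g h fix1 by simp
      then show "\<phi> (g \<otimes> x) = \<phi> g \<otimes> \<phi> x" using eqh x by simp
    qed (use fs in auto)
  next
    assume "\<phi> \<in> hom G G"
    then have "compose (carrier G) \<phi> (left_translation G g) =
        compose (carrier G) (left_translation G (\<phi> g)) \<phi>" if "g \<in> carrier G" for g
      using that compose_left_translation_eq_iff[OF fs] by (simp add: hom_mult)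
    \<comment> \<open>The composite for \<open>g\<close> in one coset is the composite for
      \<open>\<phi> g\<close> in the other. As \<open>\<phi>\<close> is onto,
      \<open>\<phi> g\<close> runs through all of \<open>carrier G\<close>, so the cosets
      agree.\<close>
    then have "\<phi> <#\<^bsub>CH_aut G \<pi>\<^esub> left_translations G =
        (\<lambda>h. compose (carrier G) (left_translation G h) \<phi>) ` (\<phi> ` carrier G)"
      unfolding lcos image_image by (rule image_cong[OF refl])
    then show "\<phi> <#\<^bsub>CH_aut G \<pi>\<^esub> left_translations G = left_translations G #>\<^bsub>CH_aut G \<pi>\<^esub> \<phi>"
      using bij_betw_imp_surj_on[OF bij] by (simp add: rcos)
  qed
  then show ?thesis
    using group.mem_normalizer_iff[OF group_CH_aut[OF sub] Lsub] \<phi> by simp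
qed

text \<open>This is where the \<open>T\<close>-axiom enters: if \<open>h <# D\<close> contains the
  identity, it is a translate of \<open>D\<close> by the inverse of one of its own elements.\<close>

lemma CH_edge_containing_one:
  assumes sub: "\<And>C. C \<in> \<pi> \<Longrightarrow> C \<subseteq> carrier G"
    and T: "T_axiom G \<pi>" and e: "e \<in> CH_edges G \<pi>" and one: "\<one> \<in> e"
  shows "e \<in> \<pi>"
proof -
  obtain h D where h: "h \<in> carrier G" and D: "D \<in> \<pi>" and e_def: "e = h <# D"
    using e by (auto simp: CH_edges_def)
  obtain d where d: "d \<in> D" "h \<otimes> d = \<one>"
    using one unfolding e_def l_coset_def by auto
  then have "h = inv d"
    using inv_equality[of h d] h sub[OF D] by auto
  then show ?thesis using T D d by (simp add: T_axiom_def e_def)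
qed

lemma hom_image_l_coset:
  assumes "\<phi> \<in> hom G G" and "g \<in> carrier G" and "C \<subseteq> carrier G"
  shows "\<phi> ` (g <# C) = \<phi> g <# \<phi> ` C"
proof -
  have "(\<lambda>x. \<phi> (g \<otimes> x)) ` C = (\<lambda>x. \<phi> g \<otimes> \<phi> x) ` C"
    using assms by (intro image_cong refl) (auto simp: hom_mult)
  then show ?thesis by (auto simp: l_coset_def)
qed

lemma auto_mem_CH_aut_iff:
  assumes fin: "finite \<pi>"
    and sub: "\<And>C. C \<in> \<pi> \<Longrightarrow> C \<subseteq> carrier G"
    and one: "\<And>C. C \<in> \<pi> \<Longrightarrow> \<one> \<in> C"
    and T: "T_axiom G \<pi>" and \<phi>: "\<phi> \<in> auto G"
  shows "\<phi> \<in> carrier (CH_aut G \<pi>) \<longleftrightarrow> \<phi> \<in> carrier (Aut_pi G \<pi>)"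
proof
  have hom: "\<phi> \<in> hom G G" using \<phi> by (simp add: auto_def)
  assume *: "\<phi> \<in> carrier (CH_aut G \<pi>)"
  have "\<phi> ` C \<in> \<pi>" if C: "C \<in> \<pi>" for C
  proof (rule CH_edge_containing_one[OF sub T])
    have "C = \<one> <# C" using sub[OF C] by (simp add: lcos_mult_one)
    then have "C \<in> CH_edges G \<pi>" using C unfolding CH_edges_def by blast
    then show "\<phi> ` C \<in> CH_edges G \<pi>"
      using * bij_betwE unfolding mem_CH_aut_iff by blast
    show "\<one> \<in> \<phi> ` C"
      using one[OF C] hom_one[OF hom is_group is_group] by (metis imageI)
  qed
  then show "\<phi> \<in> carrier (Aut_pi G \<pi>)" using \<phi> by (simp add: Aut_pi_def)
next
  have hom: "\<phi> \<in> hom G G" and bij: "bij_betw \<phi> (carrier G) (carrier G)"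
    using \<phi> by (auto simp: auto_def Bij_def)
  assume "\<phi> \<in> carrier (Aut_pi G \<pi>)"
  \<comment> \<open>Finiteness turns mapping \<open>\<pi>\<close> into itself into mapping it onto
    itself, which is what surjectivity on the hyperedges rests on.\<close>
  then have perm: "(`) \<phi> ` \<pi> = \<pi>"
    using Aut_pi_induces_permutation[OF fin sub] by (auto simp: bij_betw_def)
  have "CH_edges G \<pi> \<subseteq> Pow (carrier G)"
    using CH_edges_subset[OF sub] by blast
  then have inj: "inj_on ((`) \<phi>) (CH_edges G \<pi>)"
    using inj_on_image_Pow[OF bij_betw_imp_inj_on[OF bij]] by (rule inj_on_subset[rotated])
  have edges: "CH_edges G \<pi> = (\<lambda>(g, C). g <# C) ` (carrier G \<times> \<pi>)"
    by (auto simp: CH_edges_def)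
  have "(`) \<phi> ` CH_edges G \<pi> = (\<lambda>(g, C). \<phi> g <# \<phi> ` C) ` (carrier G \<times> \<pi>)"
    unfolding edges image_image
    by (rule image_cong) (simp_all add: hom_image_l_coset[OF hom _ sub] mem_Times_iff case_prod_beta)
  also have "\<dots> = (\<lambda>(g, C). g <# C) ` (map_prod \<phi> ((`) \<phi>) ` (carrier G \<times> \<pi>))"
    unfolding image_image by (rule image_cong) auto
  also have "\<dots> = CH_edges G \<pi>"
    using bij_betw_imp_surj_on[OF bij] perm
    by (simp only: edges map_prod_surj_on)
  finally have "bij_betw ((`) \<phi>) (CH_edges G \<pi>) (CH_edges G \<pi>)"
    using inj by (simp add: bij_betw_def)
  then show "\<phi> \<in> carrier (CH_aut G \<pi>)"
    using \<phi> by (simp add: mem_CH_aut_iff auto_def)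
qed

lemma normalizer_stabilizer_eq_Aut_pi:
  assumes "finite \<pi>"
    and sub: "\<And>C. C \<in> \<pi> \<Longrightarrow> C \<subseteq> carrier G"
    and "\<And>C. C \<in> \<pi> \<Longrightarrow> \<one> \<in> C"
    and "T_axiom G \<pi>"
  shows "normalizer (CH_aut G \<pi>) (left_translations G)
      \<inter> {\<phi> \<in> carrier (CH_aut G \<pi>). \<phi> \<one> = \<one>} = carrier (Aut_pi G \<pi>)"
proof (intro equalityI subsetI)
  fix \<phi> assume "\<phi> \<in> normalizer (CH_aut G \<pi>) (left_translations G)
      \<inter> {\<phi> \<in> carrier (CH_aut G \<pi>). \<phi> \<one> = \<one>}"
  then have \<phi>: "\<phi> \<in> carrier (CH_aut G \<pi>)" and "\<phi> \<in> hom G G"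
    using normalizer_left_translations_iff[OF sub] by auto
  \<comment> \<open>Of the two conditions in \<open>auto G\<close>, membership in
    \<open>Bij (carrier G)\<close> comes from \<open>CH_aut G \<pi>\<close>.\<close>
  then have "\<phi> \<in> auto G" by (simp add: auto_def mem_CH_aut_iff)
  then show "\<phi> \<in> carrier (Aut_pi G \<pi>)"
    using auto_mem_CH_aut_iff[OF assms] \<phi> by blast
next
  fix \<phi> assume *: "\<phi> \<in> carrier (Aut_pi G \<pi>)"
  then have \<phi>: "\<phi> \<in> auto G" by (simp add: Aut_pi_def)
  then have hom: "\<phi> \<in> hom G G" by (simp add: auto_def)
  have "\<phi> \<in> carrier (CH_aut G \<pi>)"
    using auto_mem_CH_aut_iff[OF assms \<phi>] * by blast
  then show "\<phi> \<in> normalizer (CH_aut G \<pi>) (left_translations G)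
      \<inter> {\<phi> \<in> carrier (CH_aut G \<pi>). \<phi> \<one> = \<one>}"
    using normalizer_left_translations_iff[OF sub] hom hom_one[OF hom is_group is_group] by auto
qed

end

theorem theorem8p2:
  fixes G :: "('a, 'b) monoid_scheme" and \<pi> :: "'a set set" and l k :: nat
  assumes "group G"
    and "finite \<pi>" and "card \<pi> = l"
    and "\<And>C. C \<in> \<pi> \<Longrightarrow> C \<subseteq> carrier G"
    and "\<And>C. C \<in> \<pi> \<Longrightarrow> finite C \<and> card C = k"
    and "\<And>C. C \<in> \<pi> \<Longrightarrow> \<one>\<^bsub>G\<^esub> \<in> C"
    and "\<And>C D. C \<in> \<pi> \<Longrightarrow> D \<in> \<pi> \<Longrightarrow> C \<noteq> D \<Longrightarrow> C \<inter> D = {\<one>\<^bsub>G\<^esub>}"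
    and "T_axiom G \<pi>"
  shows "(CH_aut G \<pi>) \<lparr>carrier := normalizer (CH_aut G \<pi>) (left_translations G)
            \<inter> {\<phi> \<in> carrier (CH_aut G \<pi>). \<phi> \<one>\<^bsub>G\<^esub> = \<one>\<^bsub>G\<^esub>}\<rparr>
          \<cong> Aut_pi G \<pi>"
proof -
  \<comment> \<open>Both groups are \<open>BijGroup (carrier G)\<close> with another carrier, so
    equal carriers give equal groups and the isomorphism is reflexivity.\<close>
  have "(CH_aut G \<pi>) \<lparr>carrier := carrier (Aut_pi G \<pi>)\<rparr> = Aut_pi G \<pi>"
    by (simp add: CH_aut_def hypergraph_aut_def Aut_pi_def AutoGroup_def)
  then show ?thesis
    using group.normalizer_stabilizer_eq_Aut_pi[OF assms(1,2,4,6,8)] by simp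
qed

end
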